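(* Let $\alpha\in(0,1)$, let $I=[x_\ell,x_r]\subset\mathbb R$ with $x_\ell<x_r$, and let $f\in C^{2+\alpha}(I,\mathbb R)$ be a solution of the minimal surface equation $$f(x)f''(x)=1+f'(x)^2\quad\text{in } I.$$ Assume that $f$ is stable in the sense that there exists a function $\chi\in C^{2+\alpha}(I,\mathbb R)$ with $$\chi''(x)-\frac{2f'(x)}{f(x)}\,\chi'(x)+\frac{f''(x)}{f(x)}\,\chi(x)\le 0\quad\text{and}\quad\chi(x)>0\quad\text{for all } x\in I.$$ Then for all sufficiently small $\varepsilon>0$ there exists $\psi\in C^{2+\alpha}(I,\mathbb R)$ with boundary values $|\psi(x_\ell)|\le\varepsilon$ and $|\psi(x_r)|\le\varepsilon$ such that $f+\psi$ also solves the minimal surface equation, i.e. $$(f+\psi)(f''+\psi'')=1+(f'+\psi')^2\quad\text{in } I.$$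
   Context: $C^{2+\alpha}(I,\mathbb R)$ is the space of twice continuously differentiable functions on the compact interval $I$ whose second derivative is Hölder continuous with exponent $\alpha$. Any solution $f$ of $ff''=1+f'^2$ has no zeros, so the quotients in the stability condition are well defined. *)

theory Defs
  imports "HOL-Analysis.Analysis"
begin

text \<open>Elements of a function space over a compact interval I are represented by total functions of
  which only the values on I matter. Derivatives are therefore taken within I, so that they are
  one-sided at the endpoints.\<close>

definition deriv_on :: "real set \<Rightarrow> (real \<Rightarrow> real) \<Rightarrow> real \<Rightarrow> real" where
  "deriv_on I f x = vector_derivative f (at x within I)"

definition hoelder_on :: "real \<Rightarrow> real set \<Rightarrow> (real \<Rightarrow> real) \<Rightarrow> bool" where
  "hoelder_on \<alpha> I g \<longleftrightarrow> (\<exists>C. \<forall>x\<in>I. \<forall>y\<in>I. \<bar>g x - g y\<bar> \<le> C * \<bar>x - y\<bar> powr \<alpha>)"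

definition C2_hoelder :: "real \<Rightarrow> real set \<Rightarrow> (real \<Rightarrow> real) set" where
  "C2_hoelder \<alpha> I = {f. f differentiable_on I \<and> deriv_on I f differentiable_on I \<and>
     continuous_on I (deriv_on I (deriv_on I f)) \<and> hoelder_on \<alpha> I (deriv_on I (deriv_on I f))}"

definition minimal_surface_stable :: "real \<Rightarrow> real set \<Rightarrow> (real \<Rightarrow> real) \<Rightarrow> bool" where
  "minimal_surface_stable \<alpha> I f \<longleftrightarrow> (\<exists>\<phi>\<in>C2_hoelder \<alpha> I. \<forall>x\<in>I.
     deriv_on I (deriv_on I \<phi>) x - 2 * deriv_on I f x / f x * deriv_on I \<phi> x
       + deriv_on I (deriv_on I f) x / f x * \<phi> x \<le> 0 \<and> \<phi> x > 0)"

end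

theory Submission
  imports Defs
begin

text \<open>Every solution is a catenary \<open>c cosh ((x - m) / c)\<close> with \<open>c \<noteq> 0\<close>: both \<open>f / sqrt (1 + f'\<^sup>2)\<close>
  and \<open>arsinh f' - x / c\<close> are constant. So it suffices to solve the boundary value problem within
  the two-parameter family of catenaries, for which the map from \<open>(c, m)\<close> to the boundary values
  must have an invertible derivative. Otherwise there is a Jacobi field vanishing at both end points,
  which a Sturm comparison with the positive supersolution \<open>\<phi>\<close> excludes.\<close>

section \<open>One-sided derivatives and membership in the Hoelder space\<close>

text \<open>Since \<open>a < b\<close>, derivatives within the interval are unique even at its end
  points, and they depend only on values in it. As \<open>h\<close> may differ from \<open>g\<close>
  elsewhere, the rule applies again when \<open>h\<close> is itself a
  \<open>deriv_on\<close>.\<close>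

lemma deriv_on_eqI:
  assumes "a < b" "x \<in> {a..b}"
    and "(g has_real_derivative D) (at x within {a..b})"
    and "\<And>y. y \<in> {a..b} \<Longrightarrow> h y = g y"
  shows "deriv_on {a..b} h x = D"
proof -
  have "(h has_real_derivative D) (at x within {a..b})"
    using has_field_derivative_transform_within[OF assms(3) zero_less_one assms(2)] assms(4) by metis
  then have "(h has_vector_derivative D) (at x within {a..b})"
    by (simp add: has_real_derivative_iff_has_vector_derivative)
  then show ?thesis
    unfolding deriv_on_def
    using vector_derivative_within_cbox[of a b x h D] assms(1,2) by simp
qed

lemma has_derivative_deriv_on:
  assumes "h differentiable_on I" "x \<in> I"
  shows "(h has_real_derivative deriv_on I h x) (at x within I)"
  using assms
  by (simp add: deriv_on_def has_real_derivative_iff_has_vector_derivative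
      vector_derivative_works[symmetric] differentiable_on_def)

lemma hoelder_on_if_lipschitz:
  assumes "0 < \<alpha>" "\<alpha> < 1" and "0 \<le> K"
    and lip: "\<And>x y. x \<in> {a..b} \<Longrightarrow> y \<in> {a..b} \<Longrightarrow> \<bar>h x - h y\<bar> \<le> K * \<bar>x - y\<bar>"
  shows "hoelder_on \<alpha> {a..b} h"
  unfolding hoelder_on_def
proof (intro exI ballI)
  fix x y assume xy: "x \<in> {a..b}" "y \<in> {a..b}"
  \<comment> \<open>The case \<open>x = y\<close> is covered because
    \<open>0 powr s = 0\<close>.\<close>
  have "\<bar>x - y\<bar> = \<bar>x - y\<bar> powr (1 - \<alpha>) * \<bar>x - y\<bar> powr \<alpha>"
    by (simp flip: powr_add)
  also have "\<dots> \<le> (b - a) powr (1 - \<alpha>) * \<bar>x - y\<bar> powr \<alpha>"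
    using xy assms(2) by (intro mult_right_mono powr_mono2) auto
  finally have "K * \<bar>x - y\<bar> \<le> K * ((b - a) powr (1 - \<alpha>) * \<bar>x - y\<bar> powr \<alpha>)"
    using \<open>0 \<le> K\<close> by (rule mult_left_mono)
  then show "\<bar>h x - h y\<bar> \<le> K * (b - a) powr (1 - \<alpha>) * \<bar>x - y\<bar> powr \<alpha>"
    using lip[OF xy] by (simp add: mult.assoc)
qed

text \<open>The third derivative is bounded on the compact interval, so the second one is Lipschitz
  there and thus Hoelder continuous with exponent \<open>\<alpha>\<close>.\<close>

lemma C2_hoelder_if_C3:
  assumes "0 < \<alpha>" "\<alpha> < 1" "a < b"
    and d1: "\<And>x. (h has_real_derivative h1 x) (at x)"
    and d2: "\<And>x. (h1 has_real_derivative h2 x) (at x)"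
    and d3: "\<And>x. (h2 has_real_derivative h3 x) (at x)"
    and cont: "continuous_on {a..b} h3"
  shows "h \<in> C2_hoelder \<alpha> {a..b}"
    and "\<And>x. x \<in> {a..b} \<Longrightarrow> deriv_on {a..b} h x = h1 x"
    and "\<And>x. x \<in> {a..b} \<Longrightarrow> deriv_on {a..b} (deriv_on {a..b} h) x = h2 x"
proof -
  note d1' = has_field_derivative_at_within[OF d1] and d2' = has_field_derivative_at_within[OF d2]
    and d3' = has_field_derivative_at_within[OF d3]
  show D1: "deriv_on {a..b} h x = h1 x" if "x \<in> {a..b}" for x
    by (rule deriv_on_eqI[OF \<open>a < b\<close> that d1']) simp
  show D2: "deriv_on {a..b} (deriv_on {a..b} h) x = h2 x" if "x \<in> {a..b}" for x
    by (rule deriv_on_eqI[OF \<open>a < b\<close> that d2' D1])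
  obtain K where K: "\<And>x. x \<in> {a..b} \<Longrightarrow> \<bar>h3 x\<bar> \<le> K"
    using compact_imp_bounded[OF compact_continuous_image[OF cont compact_Icc]]
    unfolding bounded_iff real_norm_def by blast
  have "0 \<le> K" using K[of a] \<open>a < b\<close> by fastforce
  have "\<bar>h2 x - h2 y\<bar> \<le> K * \<bar>x - y\<bar>" if "x \<in> {a..b}" "y \<in> {a..b}" for x y
    using field_differentiable_bound[OF convex_real_interval(5) d3' _ that(1,2), where B = K] K by simp
  then have "hoelder_on \<alpha> {a..b} h2"
    using hoelder_on_if_lipschitz[OF assms(1,2) \<open>0 \<le> K\<close>] by blast
  then have hoelder: "hoelder_on \<alpha> {a..b} (deriv_on {a..b} (deriv_on {a..b} h))"
    using D2 by (simp add: hoelder_on_def)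
  have "continuous_on {a..b} h2"
    by (rule DERIV_continuous_on[OF d3'])
  then have cont2: "continuous_on {a..b} (deriv_on {a..b} (deriv_on {a..b} h))"
    by (rule continuous_on_eq) (simp add: D2)
  have diff1: "h differentiable_on {a..b}"
    using d1' unfolding differentiable_on_def real_differentiable_def by blast
  have "(deriv_on {a..b} h has_real_derivative h2 x) (at x within {a..b})"
    if "x \<in> {a..b}" for x
    using has_field_derivative_transform_within[OF d2' zero_less_one that] D1 by metis
  then have "deriv_on {a..b} h differentiable_on {a..b}"
    unfolding differentiable_on_def real_differentiable_def by blast
  then show "h \<in> C2_hoelder \<alpha> {a..b}"
    using diff1 cont2 hoelder by (simp add: C2_hoelder_def)
qed

section \<open>Solutions of the minimal surface equation are catenaries\<close>

definition catenary :: "real \<Rightarrow> real \<Rightarrow> real \<Rightarrow> real" where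
  "catenary c m x = c * cosh ((x - m) / c)"

text \<open>The area integrand \<open>f * sqrt (1 + f1\<^sup>2)\<close> does not depend explicitly
  on \<open>x\<close>, and its conserved energy is, up to sign,
  \<open>f / sqrt (1 + f1\<^sup>2)\<close>. The value of this first integral is the scale
  \<open>c\<close>; a second integration yields the centre \<open>m\<close>.\<close>

lemma minimal_surface_solution_is_catenary:
  assumes "a < b"
    and d1: "\<And>x. x \<in> {a..b} \<Longrightarrow> (f has_real_derivative f1 x) (at x within {a..b})"
    and d2: "\<And>x. x \<in> {a..b} \<Longrightarrow> (f1 has_real_derivative f2 x) (at x within {a..b})"
    and ode: "\<And>x. x \<in> {a..b} \<Longrightarrow> f x * f2 x = 1 + (f1 x)\<^sup>2"
  obtains c m where "c \<noteq> 0" "\<And>x. x \<in> {a..b} \<Longrightarrow> f x = catenary c m x"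
proof -
  define q where "q x = sqrt (1 + (f1 x)\<^sup>2)" for x
  have q: "0 < q x" "(q x)\<^sup>2 = 1 + (f1 x)\<^sup>2" for x
    unfolding q_def by (auto simp: add_pos_nonneg)
  have dq: "(q has_real_derivative f1 x * f2 x / q x) (at x within {a..b})" if "x \<in> {a..b}" for x
    unfolding q_def using q(1)[of x]
    by (auto intro!: derivative_eq_intros d2[OF that] simp: q_def field_simps)
  have "((\<lambda>x. f x / q x) has_real_derivative 0) (at x within {a..b})" if "x \<in> {a..b}" for x
  proof -
    have "(f1 x * q x - f x * (f1 x * f2 x / q x)) * q x = f1 x * ((q x)\<^sup>2 - f x * f2 x)"
      using q(1)[of x] by (simp add: field_simps power2_eq_square)
    also have "\<dots> = 0" using ode[OF that] q(2)[of x] by simp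
    finally have "f1 x * q x - f x * (f1 x * f2 x / q x) = 0" using q(1)[of x] by simp
    then show ?thesis
      using DERIV_divide[OF d1[OF that] dq[OF that]] q(1)[of x] by simp
  qed
  then obtain c where c: "\<And>x. x \<in> {a..b} \<Longrightarrow> f x / q x = c"
    using has_field_derivative_zero_constant[of "{a..b}" "\<lambda>x. f x / q x"] by auto
  then have fc: "f x = c * q x" if "x \<in> {a..b}" for x
    using c[OF that] q(1)[of x] by (simp add: divide_eq_eq)
  have "c \<noteq> 0"
  proof
    assume "c = 0"
    then have "1 + (f1 a)\<^sup>2 = 0" using ode[of a] fc[of a] \<open>a < b\<close> by simp
    then show False by (simp add: add_nonneg_eq_0_iff)
  qed
  \<comment> \<open>With \<open>f = c * q\<close>, the equation \<open>f * f2 = q\<^sup>2\<close>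
    reduces to \<open>f2 / q = 1 / c\<close>, and \<open>f2 / q\<close> is the derivative of
    \<open>arsinh f1\<close>.\<close>
  have "((\<lambda>x. arsinh (f1 x) - x / c) has_real_derivative 0) (at x within {a..b})"
    if "x \<in> {a..b}" for x
  proof -
    have "q x * (c * f2 x) = q x * q x"
      using ode[OF that] fc[OF that] q(2)[of x] by (simp add: power2_eq_square mult_ac)
    then have "c * f2 x = q x" using q(1)[of x] by simp
    then have "f2 x / q x = 1 / c" using q(1)[of x] \<open>c \<noteq> 0\<close> by (simp add: field_simps)
    then have eq: "1 / sqrt ((f1 x)\<^sup>2 + 1) * f2 x - 1 / c = 0" by (simp add: q_def add.commute)
    show ?thesis
      using DERIV_diff[OF DERIV_chain2[OF arsinh_real_has_field_derivative d2[OF that]] 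
          DERIV_cdivide[OF DERIV_ident], of c] eq by simp
  qed
  then obtain d where d: "\<And>x. x \<in> {a..b} \<Longrightarrow> arsinh (f1 x) - x / c = d"
    using has_field_derivative_zero_constant[of "{a..b}" "\<lambda>x. arsinh (f1 x) - x / c"] by auto
  \<comment> \<open>The centre comes from solving \<open>x / c + d = (x - m) / c\<close> for
    \<open>m\<close>.\<close>
  have "f x = catenary c (- c * d) x" if "x \<in> {a..b}" for x
  proof -
    have "(x - - c * d) / c = arsinh (f1 x)"
      using d[OF that] \<open>c \<noteq> 0\<close> by (auto simp: field_simps)
    then show ?thesis
      using fc[OF that] by (simp add: catenary_def cosh_arsinh_real q_def add.commute)
  qed
  with \<open>c \<noteq> 0\<close> show ?thesis by (rule that)
qed

section \<open>Sturm comparison\<close>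

text \<open>As long as \<open>v\<close> is positive, a weighted Wronskian of \<open>\<phi>\<close>
  and \<open>v\<close> cannot decrease from its positive initial value. This forces
  \<open>v / \<phi>\<close> to increase strictly from 0, so there is no first point after
  \<open>a\<close> at which \<open>v\<close> fails to be positive.\<close>

lemma sturm_positive_supersolution:
  fixes v \<phi> f :: "real \<Rightarrow> real"
  assumes "a < b"
    and dv: "\<And>x. x \<in> {a..b} \<Longrightarrow> (v has_real_derivative v1 x) (at x within {a..b})"
      "\<And>x. x \<in> {a..b} \<Longrightarrow> (v1 has_real_derivative v2 x) (at x within {a..b})"
    and d\<phi>: "\<And>x. x \<in> {a..b} \<Longrightarrow> (\<phi> has_real_derivative \<phi>1 x) (at x within {a..b})"
      "\<And>x. x \<in> {a..b} \<Longrightarrow> (\<phi>1 has_real_derivative \<phi>2 x) (at x within {a..b})"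
    and df: "\<And>x. x \<in> {a..b} \<Longrightarrow> (f has_real_derivative f1 x) (at x within {a..b})"
    and f: "\<And>x. x \<in> {a..b} \<Longrightarrow> f x \<noteq> 0"
    and sol: "\<And>x. x \<in> {a..b} \<Longrightarrow> v2 x - 2 * f1 x / f x * v1 x + r x * v x = 0"
    and super: "\<And>x. x \<in> {a..b} \<Longrightarrow> \<phi>2 x - 2 * f1 x / f x * \<phi>1 x + r x * \<phi> x \<le> 0"
    and pos: "\<And>x. x \<in> {a..b} \<Longrightarrow> 0 < \<phi> x"
    and init: "v a = 0" "0 < v1 a"
  shows "0 < v b"
proof (rule ccontr)
  assume "\<not> 0 < v b"
  obtain d where d: "0 < d" "\<And>h. 0 < h \<Longrightarrow> a + h \<in> {a..b} \<Longrightarrow> h < d \<Longrightarrow> v a < v (a + h)"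
    using has_real_derivative_pos_inc_right[OF dv(1) init(2)] \<open>a < b\<close> by auto
  have cv: "continuous_on {a..b} v" by (rule DERIV_continuous_on[OF dv(1)])
  \<comment> \<open>\<open>v\<close> vanishes at \<open>a\<close> itself, so the first later point
    with \<open>v \<le> 0\<close> is sought in the compact set \<open>{e..b}\<close>; to the left of
    \<open>e\<close> the sign of \<open>v1 a\<close> keeps \<open>v\<close> positive.\<close>
  define e where "e = min (a + d / 2) b"
  have e: "a < e" "e \<le> b" "e < a + d" using d(1) \<open>a < b\<close> by (auto simp: e_def)
  define Z where "Z = {x \<in> {e..b}. v x \<le> 0}"
  have "closed Z"
    unfolding Z_def
    using e by (intro continuous_on_closed_Collect_le continuous_on_const continuous_on_subset[OF cv]) auto
  then have "compact Z"
    using bounded_subset[OF bounded_closed_interval[of e b], of Z]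
    unfolding compact_eq_bounded_closed by (auto simp: Z_def subset_iff)
  moreover have "b \<in> Z" using e \<open>\<not> 0 < v b\<close> by (simp add: Z_def)
  ultimately obtain t where t: "t \<in> Z" "\<And>s. s \<in> Z \<Longrightarrow> t \<le> s"
    using compact_attains_inf[of Z] by auto
  have tab: "a < t" "t \<le> b" "v t \<le> 0" using t(1) e by (auto simp: Z_def)
  have vpos: "0 < v x" if "a < x" "x < t" for x
  proof (cases "x < e")
    case True then show ?thesis using d(2)[of "x - a"] that e init(1) by auto
  next
    case False then show ?thesis using t(2)[of x] that tab by (force simp: Z_def)
  qed
  \<comment> \<open>The weight \<open>1 / f\<^sup>2\<close> is an integrating factor: \<open>W' = - v L\<phi> / f\<^sup>2\<close>, where
    \<open>L\<phi> \<le> 0\<close> is the left-hand side of \<open>super\<close>. Moreover \<open>(v / \<phi>)' = W f\<^sup>2 / \<phi>\<^sup>2\<close>.\<close>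
  define W where "W x = (\<phi> x * v1 x - \<phi>1 x * v x) / (f x)\<^sup>2" for x
  have dW: "(W has_real_derivative 
      - v x * (\<phi>2 x - 2 * f1 x / f x * \<phi>1 x + r x * \<phi> x) / (f x)\<^sup>2) (at x within {a..b})"
    if "x \<in> {a..b}" for x
  proof -
    have "f x * v2 x = 2 * f1 x * v1 x - r x * v x * f x"
      using sol[OF that] f[OF that] by (simp add: field_simps)
    then have "\<phi> x * (f x * v2 x) = \<phi> x * (2 * f1 x * v1 x - r x * v x * f x)"
      by simp
    \<comment> \<open>After \<open>v2\<close> is eliminated through \<open>sol\<close>, the terms in
      \<open>v1\<close> cancel, and only \<open>- v\<close> times the supersolution expression,
      multiplied by \<open>f\<close>, remains.\<close>
    then have eq: "f x * (\<phi> x * v2 x - \<phi>2 x * v x) - 2 * f1 x * (\<phi> x * v1 x - \<phi>1 x * v x)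
        = - v x * (f x * \<phi>2 x - 2 * f1 x * \<phi>1 x + f x * r x * \<phi> x)"
      by (simp add: algebra_simps)
    have "((\<lambda>x. \<phi> x * v1 x - \<phi>1 x * v x) has_real_derivative \<phi> x * v2 x - \<phi>2 x * v x)
        (at x within {a..b})"
      by (rule DERIV_cong[OF DERIV_diff[OF DERIV_mult[OF d\<phi>(1)[OF that] dv(2)[OF that]]
              DERIV_mult[OF d\<phi>(2)[OF that] dv(1)[OF that]]]]) (simp add: algebra_simps)
    from DERIV_divide[OF this DERIV_power[OF df[OF that], of 2]] f[OF that]
    have dW': "(W has_real_derivative ((\<phi> x * v2 x - \<phi>2 x * v x) * (f x)\<^sup>2
        - (\<phi> x * v1 x - \<phi>1 x * v x) * (2 * f1 x * f x)) / ((f x)\<^sup>2 * (f x)\<^sup>2))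
        (at x within {a..b})"
      unfolding W_def by (simp add: mult.assoc)
    have "(W has_real_derivative (f x * (\<phi> x * v2 x - \<phi>2 x * v x)
        - 2 * f1 x * (\<phi> x * v1 x - \<phi>1 x * v x)) / f x ^ 3) (at x within {a..b})"
      by (rule DERIV_cong[OF dW']) (use f[OF that] in \<open>simp add: field_simps eval_nat_numeral\<close>)
    then show ?thesis
      unfolding eq
      by (rule DERIV_cong) (use f[OF that] in \<open>simp add: field_simps eval_nat_numeral\<close>)
  qed
  \<comment> \<open>Monotonicity is claimed only up to \<open>t\<close>, since the sign of the
    derivative of \<open>W\<close> relies on \<open>v > 0\<close>.\<close>
  have W_mono: "W a \<le> W s" if "a \<le> s" "s \<le> t" for s
  proof (rule DERIV_nonneg_imp_increasing_open[OF that(1)])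
    show "continuous_on {a..s} W"
      using continuous_on_subset[OF DERIV_continuous_on[OF dW]] that tab by auto
    fix x assume x: "a < x" "x < s"
    have "(W has_real_derivative 
      - v x * (\<phi>2 x - 2 * f1 x / f x * \<phi>1 x + r x * \<phi> x) / (f x)\<^sup>2) (at x)"
      using dW[of x] x that tab by (simp add: at_within_Icc_at)
    moreover have "0 \<le> - v x * (\<phi>2 x - 2 * f1 x / f x * \<phi>1 x + r x * \<phi> x) / (f x)\<^sup>2"
      using super[of x] vpos[of x] x that tab
      by (intro divide_nonneg_nonneg mult_nonpos_nonpos) auto
    ultimately show "\<exists>y. DERIV W x :> y \<and> 0 \<le> y" by blast
  qed
  have "0 < W a"
    using init pos[of a] f[of a] \<open>a < b\<close> by (simp add: W_def)
  have dw: "((\<lambda>x. v x / \<phi> x) has_real_derivative W x * (f x)\<^sup>2 / (\<phi> x)\<^sup>2) (at x within {a..b})"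
    if "x \<in> {a..b}" for x
    using DERIV_divide[OF dv(1)[OF that] d\<phi>(1)[OF that]] pos[OF that] f[OF that]
    by (simp add: W_def power2_eq_square mult.commute)
  have "v a / \<phi> a < v t / \<phi> t"
  proof (rule DERIV_pos_imp_increasing_open[OF tab(1)])
    show "continuous_on {a..t} (\<lambda>x. v x / \<phi> x)"
      using continuous_on_subset[OF DERIV_continuous_on[OF dw]] tab by auto
    fix x assume x: "a < x" "x < t"
    have "((\<lambda>x. v x / \<phi> x) has_real_derivative W x * (f x)\<^sup>2 / (\<phi> x)\<^sup>2) (at x)"
      using dw[of x] x tab by (simp add: at_within_Icc_at)
    moreover have "0 < W x * (f x)\<^sup>2 / (\<phi> x)\<^sup>2"
      using W_mono[of x] \<open>0 < W a\<close> pos[of x] f[of x] x tab by simp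
    ultimately show "\<exists>y. DERIV (\<lambda>x. v x / \<phi> x) x :> y \<and> 0 < y" by blast
  qed
  then show False
    using init(1) tab pos[of t] by (simp add: zero_less_divide_iff)
qed

section \<open>Jacobi fields and the boundary value map of the catenary family\<close>

lemma catenary_has_derivative:
  assumes "c \<noteq> 0"
  shows "(catenary c m has_real_derivative sinh ((x - m) / c)) (at x)"
    and "((\<lambda>x. sinh ((x - m) / c)) has_real_derivative cosh ((x - m) / c) / c) (at x)"
    and "((\<lambda>x. cosh ((x - m) / c) / c) has_real_derivative sinh ((x - m) / c) / c\<^sup>2) (at x)"
  unfolding catenary_def[abs_def]
  by (auto intro!: derivative_eq_intros simp: assms power2_eq_square)

text \<open>The determinant below is, up to sign, the Jacobian of the boundary values of
  \<^term>\<open>catenary c m\<close> with respect to \<open>(c, m)\<close>. Viewed as a function of the right end point it is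
  a Jacobi field vanishing at the left one.\<close>

lemma stable_catenary_jacobian_nonzero:
  fixes c m :: real
  assumes "a < b" "c \<noteq> 0"
    and d\<phi>: "\<And>x. x \<in> {a..b} \<Longrightarrow> (\<phi> has_real_derivative \<phi>1 x) (at x within {a..b})"
      "\<And>x. x \<in> {a..b} \<Longrightarrow> (\<phi>1 has_real_derivative \<phi>2 x) (at x within {a..b})"
    and super: "\<And>x. x \<in> {a..b} \<Longrightarrow> \<phi>2 x - 2 * sinh ((x - m) / c) / catenary c m x * \<phi>1 x
        + (cosh ((x - m) / c) / c) / catenary c m x * \<phi> x \<le> 0"
    and pos: "\<And>x. x \<in> {a..b} \<Longrightarrow> 0 < \<phi> x"
  defines "A \<equiv> (a - m) / c" and "B \<equiv> (b - m) / c"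
  shows "(cosh A - A * sinh A) * sinh B - sinh A * (cosh B - B * sinh B) \<noteq> 0"
proof -
  define u where "u x = (x - m) / c" for x
  define k where "k = cosh A - A * sinh A"
  \<comment> \<open>The derivatives of \<open>catenary c m x\<close> in \<open>m\<close> and in
    \<open>c\<close> are \<open>- sinh (u x)\<close> and
    \<open>cosh (u x) - u x * sinh (u x)\<close>; \<open>v\<close> is the combination of these that
    vanishes at \<open>a\<close>. The factor \<open>c\<close> makes
    \<open>v1 a = (cosh A)\<^sup>2\<close>, positive whatever the sign of \<open>c\<close>.\<close>
  define v where "v x = c * (k * sinh (u x) - sinh A * (cosh (u x) - u x * sinh (u x)))" for x
  define v1 where "v1 x = k * cosh (u x) + sinh A * (u x * cosh (u x))" for x
  define v2 where
    "v2 x = (k * sinh (u x) + sinh A * (cosh (u x) + u x * sinh (u x))) / c" for x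
  have du: "(u has_real_derivative 1 / c) (at x within S)" for x S
    unfolding u_def using \<open>c \<noteq> 0\<close> by (auto intro!: derivative_eq_intros)
  have dv: "(v has_real_derivative v1 x) (at x within S)" for x S
    unfolding v_def v1_def using \<open>c \<noteq> 0\<close> 
    by (auto intro!: derivative_eq_intros du simp: field_simps)
  have dv1: "(v1 has_real_derivative v2 x) (at x within S)" for x S
    unfolding v1_def v2_def using \<open>c \<noteq> 0\<close> 
    by (auto intro!: derivative_eq_intros du simp: field_simps)
  have "0 < v b"
  proof (rule sturm_positive_supersolution[OF \<open>a < b\<close> dv dv1 d\<phi>
        has_field_derivative_at_within[OF catenary_has_derivative(1)[OF \<open>c \<noteq> 0\<close>, of m]]
        _ _ super pos])
    show "catenary c m x \<noteq> 0" for x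
      using \<open>c \<noteq> 0\<close> cosh_real_pos[of "(x - m) / c"] by (simp add: catenary_def)
    show "v2 x - 2 * sinh ((x - m) / c) / catenary c m x * v1 x
        + cosh ((x - m) / c) / c / catenary c m x * v x = 0" for x
      using \<open>c \<noteq> 0\<close> cosh_real_pos[of "u x"]
      unfolding v_def v1_def v2_def catenary_def u_def[symmetric]
      by (simp add: field_simps power2_eq_square)
    show "v a = 0" by (simp add: v_def u_def A_def[symmetric] k_def algebra_simps)
    have "v1 a = (cosh A)\<^sup>2"
      by (simp add: v1_def u_def A_def[symmetric] k_def algebra_simps power2_eq_square)
    then show "0 < v1 a" by simp
  qed
  \<comment> \<open>\<open>v b\<close> is \<open>c\<close> times the determinant.\<close>
  then show ?thesis
    by (auto simp: v_def u_def B_def k_def)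
qed

text \<open>The map from \<open>(c, m)\<close> to the two boundary values is continuous for
  \<open>c \<noteq> 0\<close>, and its derivative at the given point has a right inverse. By
  Sussmann's open mapping theorem its image then contains a neighbourhood of the given boundary
  values.\<close>

lemma catenary_boundary_values_locally_onto:
  fixes c m a b :: real
  assumes "c \<noteq> 0"
  defines "A \<equiv> (a - m) / c" and "B \<equiv> (b - m) / c"
  assumes det: "(cosh A - A * sinh A) * sinh B - sinh A * (cosh B - B * sinh B) \<noteq> 0"
  obtains \<delta> where "0 < \<delta>"
    "\<And>y z. \<bar>y - catenary c m a\<bar> \<le> \<delta> \<Longrightarrow> \<bar>z - catenary c m b\<bar> \<le> \<delta> \<Longrightarrow>
      \<exists>c' m'. c' \<noteq> 0 \<and> catenary c' m' a = y \<and> catenary c' m' b = z"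
proof -
  define F where "F p = (catenary (fst p) (snd p) a, catenary (fst p) (snd p) b)" for p
  define S where "S = {p :: real \<times> real. fst p \<noteq> 0}"
  define D where "D = (cosh A - A * sinh A) * sinh B - sinh A * (cosh B - B * sinh B)"
  define F' where "F' p = ((cosh A - A * sinh A) * fst p - sinh A * snd p,
      (cosh B - B * sinh B) * fst p - sinh B * snd p)" for p :: "real \<times> real"
  \<comment> \<open>Cramer's rule for \<open>F'\<close>, whose determinant is
    \<open>- D\<close>.\<close>
  define G where "G p = ((sinh B * fst p - sinh A * snd p) / D,
      ((cosh B - B * sinh B) * fst p - (cosh A - A * sinh A) * snd p) / D)" for p :: "real \<times> real"
  have S: "open S" unfolding S_def
    by (intro open_Collect_neq continuous_intros)
  have contF: "continuous_on S F"
    unfolding F_def S_def catenary_def by (intro continuous_intros) auto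
  have dcat: "((\<lambda>p. catenary (fst p) (snd p) x) has_derivative
      (\<lambda>p. (cosh ((x - m) / c) - (x - m) / c * sinh ((x - m) / c)) * fst p
        - sinh ((x - m) / c) * snd p)) (at (c, m))" for x
  proof -
    have "((\<lambda>p. (x - snd p) / fst p) has_derivative
        (\<lambda>p. - snd p / c - (x - m) / c * (fst p / c))) (at (c, m))"
      using \<open>c \<noteq> 0\<close>
      by (auto intro!: derivative_eq_intros simp: field_simps fun_eq_iff)
    from DERIV_compose_FDERIV[OF has_field_derivative_cosh[OF DERIV_ident] this]
    have "((\<lambda>p. cosh ((x - snd p) / fst p)) has_derivative
        (\<lambda>p. (- snd p / c - (x - m) / c * (fst p / c)) * sinh ((x - m) / c))) (at (c, m))"
      by simp
    from has_derivative_mult[OF has_derivative_fst[OF has_derivative_ident] this]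
    show ?thesis
      unfolding catenary_def
      by (rule has_derivative_eq_rhs) (use \<open>c \<noteq> 0\<close> in \<open>simp add: fun_eq_iff field_simps\<close>)
  qed
  have dF: "(F has_derivative F') (at (c, m))"
    unfolding F_def F'_def A_def B_def
    by (rule has_derivative_Pair[OF dcat dcat])
  have blG: "bounded_linear G"
    unfolding G_def
    by (intro bounded_linear_Pair bounded_linear_divide[THEN bounded_linear_compose]
        bounded_linear_sub bounded_linear_mult_right[THEN bounded_linear_compose]
        bounded_linear_fst bounded_linear_snd)
  have FG: "F' \<circ> G = id"
  proof
    fix p :: "real \<times> real"
    have "D \<noteq> 0" using det by (simp add: D_def)
    show "(F' \<circ> G) p = id p"
    proof (rule prod_eqI)
      have "fst ((F' \<circ> G) p) = D * fst p / D"
        unfolding D_def F'_def G_def o_def by (simp add: field_simps add_divide_distrib diff_divide_distrib)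
      then show "fst ((F' \<circ> G) p) = fst (id p)" using \<open>D \<noteq> 0\<close> by simp
      have "snd ((F' \<circ> G) p) = D * snd p / D"
        unfolding D_def F'_def G_def o_def by (simp add: field_simps add_divide_distrib diff_divide_distrib)
      then show "snd ((F' \<circ> G) p) = snd (id p)" using \<open>D \<noteq> 0\<close> by simp
    qed
  qed
  have "(c, m) \<in> S" using \<open>c \<noteq> 0\<close> by (simp add: S_def)
  then have "F (c, m) \<in> interior (F ` S)"
    using sussmann_open_mapping[OF S contF _ dF blG FG] by (simp add: S interior_open)
  then obtain e where e: "0 < e" "cball (F (c, m)) e \<subseteq> F ` S"
    by (auto simp: mem_interior_cball)
  \<comment> \<open>Half the radius suffices because the Euclidean distance in the plane is at most
    the sum of the two coordinate distances.\<close>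
  show ?thesis
  proof (rule that[of "e / 2"])
    fix y z assume yz: "\<bar>y - catenary c m a\<bar> \<le> e / 2" "\<bar>z - catenary c m b\<bar> \<le> e / 2"
    have "dist (F (c, m)) (y, z) \<le> \<bar>catenary c m a - y\<bar> + \<bar>catenary c m b - z\<bar>"
      unfolding F_def dist_Pair_Pair fst_conv snd_conv dist_real_def
      by (rule sqrt_sum_squares_le_sum_abs[THEN order_trans]) simp
    also have "\<dots> \<le> e" using yz by linarith
    finally have "(y, z) \<in> F ` S" using e(2) by auto
    then show "\<exists>c' m'. c' \<noteq> 0 \<and> catenary c' m' a = y \<and> catenary c' m' b = z"
      by (auto simp: F_def S_def)
  qed (use e in simp)
qed

text \<open>The boundary values \<open>a\<close> and \<open>b\<close> of \<open>\<psi>\<close> are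
  prescribed arbitrarily within the bound: a mere existence claim with small boundary values would
  be met by \<open>\<psi> = 0\<close>. The threshold is the radius from the local surjectivity of
  the boundary value map.\<close>

theorem theorem1:
  fixes \<alpha> xl xr :: real and I :: "real set" and f :: "real \<Rightarrow> real"
  assumes "0 < \<alpha>" and "\<alpha> < 1"
    and "xl < xr" and "I = {xl..xr}"
    and "f \<in> C2_hoelder \<alpha> I"
    and "\<forall>x\<in>I. f x * deriv_on I (deriv_on I f) x = 1 + (deriv_on I f x)\<^sup>2"
    and "minimal_surface_stable \<alpha> I f"
  shows "\<exists>\<epsilon>\<^sub>0>0. \<forall>\<epsilon>. 0 < \<epsilon> \<and> \<epsilon> < \<epsilon>\<^sub>0 \<longrightarrow>
    (\<forall>a b. \<bar>a\<bar> \<le> \<epsilon> \<and> \<bar>b\<bar> \<le> \<epsilon> \<longrightarrow>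
      (\<exists>\<psi>\<in>C2_hoelder \<alpha> I. \<psi> xl = a \<and> \<psi> xr = b \<and>
        (\<forall>x\<in>I. (f x + \<psi> x) * (deriv_on I (deriv_on I f) x + deriv_on I (deriv_on I \<psi>) x)
          = 1 + (deriv_on I f x + deriv_on I \<psi> x)\<^sup>2)))"
proof -
  note I = \<open>I = {xl..xr}\<close>
  have C2_deriv: "(h has_real_derivative deriv_on I h x) (at x within I)"
      "(deriv_on I h has_real_derivative deriv_on I (deriv_on I h) x) (at x within I)"
    if "h \<in> C2_hoelder \<alpha> I" "x \<in> I" for h x
    using that by (simp_all add: C2_hoelder_def has_derivative_deriv_on)
  obtain c m where c: "c \<noteq> 0" and f: "\<And>x. x \<in> I \<Longrightarrow> f x = catenary c m x"
    using minimal_surface_solution_is_catenary[OF \<open>xl < xr\<close> 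
        C2_deriv[OF \<open>f \<in> C2_hoelder \<alpha> I\<close>, unfolded I]] assms(6) unfolding I by blast
  have f1: "deriv_on I f x = sinh ((x - m) / c)" if "x \<in> I" for x
    using that unfolding I
    by (rule deriv_on_eqI[OF \<open>xl < xr\<close> _
          has_field_derivative_at_within[OF catenary_has_derivative(1)[OF c]]])
      (simp add: f[unfolded I])
  have f2: "deriv_on I (deriv_on I f) x = cosh ((x - m) / c) / c" if "x \<in> I" for x
    using that unfolding I
    by (rule deriv_on_eqI[OF \<open>xl < xr\<close> _
          has_field_derivative_at_within[OF catenary_has_derivative(2)[OF c]]])
      (simp add: f1[unfolded I])
  obtain \<phi> where \<phi>: "\<phi> \<in> C2_hoelder \<alpha> I" and
    super: "\<And>x. x \<in> I \<Longrightarrow> deriv_on I (deriv_on I \<phi>) x 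
      - 2 * sinh ((x - m) / c) / catenary c m x * deriv_on I \<phi> x
      + (cosh ((x - m) / c) / c) / catenary c m x * \<phi> x \<le> 0" and
    pos: "\<And>x. x \<in> I \<Longrightarrow> 0 < \<phi> x"
    using assms(7) unfolding minimal_surface_stable_def by (auto simp: f f1 f2 cong: ball_cong)
  obtain \<delta> where \<delta>: "0 < \<delta>"
    "\<And>y z. \<bar>y - catenary c m xl\<bar> \<le> \<delta> \<Longrightarrow> \<bar>z - catenary c m xr\<bar> \<le> \<delta> \<Longrightarrow>
      \<exists>c' m'. c' \<noteq> 0 \<and> catenary c' m' xl = y \<and> catenary c' m' xr = z"
    using catenary_boundary_values_locally_onto[OF c stable_catenary_jacobian_nonzero[OF
          \<open>xl < xr\<close> c C2_deriv[OF \<phi>, unfolded I] super[unfolded I] pos[unfolded I]]] by blast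
  have "\<exists>\<psi>\<in>C2_hoelder \<alpha> I. \<psi> xl = a \<and> \<psi> xr = b \<and>
        (\<forall>x\<in>I. (f x + \<psi> x) * (deriv_on I (deriv_on I f) x + deriv_on I (deriv_on I \<psi>) x)
          = 1 + (deriv_on I f x + deriv_on I \<psi> x)\<^sup>2)"
    if "\<bar>a\<bar> \<le> \<delta>" "\<bar>b\<bar> \<le> \<delta>" for a b
  proof -
    have "\<exists>c' m'. c' \<noteq> 0 \<and> catenary c' m' xl = catenary c m xl + a
        \<and> catenary c' m' xr = catenary c m xr + b"
      by (rule \<delta>(2)) (use that in simp_all)
    then obtain c' m' where c': "c' \<noteq> 0"
      and bd: "catenary c' m' xl = catenary c m xl + a" "catenary c' m' xr = catenary c m xr + b"
      by blast
    \<comment> \<open>Subtracting the catenary formula instead of \<open>f\<close>, which is known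
      only on \<open>I\<close>, makes \<open>\<psi>\<close> smooth on the whole line, as
      \<open>C2_hoelder_if_C3\<close> requires.\<close>
    define \<psi> where "\<psi> x = catenary c' m' x - catenary c m x" for x
    note d = catenary_has_derivative[OF c', of m'] and e = catenary_has_derivative[OF c, of m]
    have "continuous_on {xl..xr} (\<lambda>x. sinh ((x - m') / c') / c'\<^sup>2 - sinh ((x - m) / c) / c\<^sup>2)"
      by (intro continuous_intros) (use c c' in auto)
    note C3 = C2_hoelder_if_C3[OF assms(1-3) DERIV_diff[OF d(1) e(1)] DERIV_diff[OF d(2) e(2)]
        DERIV_diff[OF d(3) e(3)] this, folded \<psi>_def I]
    show ?thesis
    proof (intro bexI[OF _ C3(1)] conjI ballI)
      show "\<psi> xl = a" "\<psi> xr = b" using bd by (auto simp: \<psi>_def)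
      fix x assume x: "x \<in> I"
      show "(f x + \<psi> x) * (deriv_on I (deriv_on I f) x + deriv_on I (deriv_on I \<psi>) x)
          = 1 + (deriv_on I f x + deriv_on I \<psi> x)\<^sup>2"
        using c' cosh_square_eq[of "(x - m') / c'"]
        by (simp add: C3(2,3)[OF x] f[OF x] f1[OF x] f2[OF x] \<psi>_def catenary_def
            power2_eq_square)
    qed
  qed
  then show ?thesis
    by (intro exI[of _ \<delta>] conjI allI impI \<delta>(1)) (meson less_imp_le order.trans)
qed

end
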